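(* Let $r,s,t\in\mathbb{C}\setminus\{0,1\}$ be pairwise distinct. For $(R,S,T,c_r,c_s,c_t)\in\mathbb{C}^6$ let $\underline\theta=c_r\underline\theta_r+c_s\underline\theta_s+c_t\underline\theta_t$, where for $(i,Z)\in\{(r,R),(s,S),(t,T)\}$ $$\underline\theta_i=\begin{pmatrix}0&0\\1-Z&0\end{pmatrix}\frac{\mathrm{d}x}{x}+\begin{pmatrix}Z&-Z\\Z&-Z\end{pmatrix}\frac{\mathrm{d}x}{x-1}+\begin{pmatrix}-Z&Z^2\\-1&Z\end{pmatrix}\frac{\mathrm{d}x}{x-i}.$$ Then $$\det(\underline\theta)=(h_2x^2+h_1x+h_0)\,\frac{(\mathrm{d}x)^{\otimes2}}{x(x-1)(x-r)(x-s)(x-t)},$$ where $$h_0=\big(c_r(R-1)+c_s(S-1)+c_t(T-1)\big)\big(c_r\,st(R-r)R+c_s\,rt(S-s)S+c_t\,rs(T-t)T\big),$$ $$\begin{aligned}h_1=\;&c_r\big(c_r(s+t)(r+1)+c_ss(t+1)+c_tt(s+1)\big)R^2-c_r^2(t+s)R^3\\&+c_s\big(c_s(r+t)(s+1)+c_rr(t+1)+c_tt(r+1)\big)S^2-c_s^2(t+r)S^3\\&+c_t\big(c_t(r+s)(t+1)+c_rr(s+1)+c_ss(r+1)\big)T^2-c_t^2(r+s)T^3\\&-c_rc_s\big(t(R-1+S-1)+r(S-s)+s(R-r)\big)RS\\&-c_rc_t\big(s(R-1+T-1)+r(T-t)+t(R-r)\big)RT\\&-c_sc_t\big(r(S-1+T-1)+s(T-t)+t(S-s)\big)ST\\&-\big(c_tt(r+s)+c_rr(s+t)+c_ss(r+t)\big)(c_rR+c_sS+c_tT),\end{aligned}$$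 $$h_2=\big(c_r(R-1)R+c_s(S-1)S+c_t(T-1)T\big)\big(c_r(R-r)+c_s(S-s)+c_t(T-t)\big).$$
   Context: Here $\underline\theta$ is the universal trace free logarithmic Higgs field on $\mathcal{O}_{\mathbb{P}^1}(-1)\oplus\mathcal{O}_{\mathbb{P}^1}(-2)$ with poles over $\{0,1,r,s,t,\infty\}$, written as a $2\times2$ matrix of meromorphic $1$-forms in the affine coordinate $x$ of $\mathbb{P}^1$; $(R,S,T)$ are coordinates on an affine chart of the moduli space of quasi-parabolic bundles and $(c_r,c_s,c_t)$ the dual cotangent coordinates. The determinant is the usual $2\times 2$ determinant, with values in quadratic differentials. The functions $h_0,h_1,h_2$ are the Hitchin Hamiltonians in these coordinates.
   Formalization: The printed formula has a sign error: with these matrices and h_0, h_1, h_2, det(θ) equals minus the stated right-hand side (e.g. c_r=1, c_s=c_t=0, r=2, R=-1 gives 6/(x(x-1)(x-2)), not -6/(x(x-1)(x-2))); the formal theorem inserts this minus sign. *)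

theory Defs
  imports "HOL-Analysis.Analysis" "HOL-Computational_Algebra.Polynomial_Factorial"
begin

text \<open>
  Meromorphic functions on the projective line are the rational functions \<open>\<complex>(x)\<close>, and the
  meromorphic \<open>k\<close>-differentials form the one-dimensional \<open>\<complex>(x)\<close>-space spanned by
  \<open>(dx)\<^sup>\<otimes>\<^sup>k\<close>. The tensor products of all degrees are collected in the symmetric algebra
  \<open>\<complex>(x)[dx]\<close>, a polynomial ring over \<open>\<complex>(x)\<close> in the one variable \<open>dx\<close>: its homogeneous elements of
  degree \<open>1\<close> are the meromorphic \<open>1\<close>-forms, those of degree \<open>2\<close> the quadratic differentials, and
  its product is the tensor product. Since this ring is commutative, the library determinant
  applies to matrices of \<open>1\<close>-forms.
\<close>

type_synonym ratfun = "complex poly fract"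

type_synonym differential = "ratfun poly"

definition cst :: "complex \<Rightarrow> ratfun" where
  "cst a = to_fract [:a:]"

definition X :: ratfun where
  "X = to_fract [:0, 1:]"

definition dx :: differential where
  "dx = monom 1 1"

definition matrix_times_form :: "complex^2^2 \<Rightarrow> differential \<Rightarrow> differential^2^2" where
  "matrix_times_form A \<omega> = (\<chi> i j. smult (cst (A $ i $ j)) \<omega>)"

definition scale_matrix :: "complex \<Rightarrow> differential^2^2 \<Rightarrow> differential^2^2" where
  "scale_matrix c M = (\<chi> i j. smult (cst c) (M $ i $ j))"

definition theta_basic :: "complex \<Rightarrow> complex \<Rightarrow> differential^2^2" where
  "theta_basic i Z =
     matrix_times_form (vector [vector [0, 0], vector [1 - Z, 0]]) (smult (1 / X) dx)
   + matrix_times_form (vector [vector [Z, - Z], vector [Z, - Z]]) (smult (1 / (X - 1)) dx)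
   + matrix_times_form (vector [vector [- Z, Z\<^sup>2], vector [- 1, Z]]) (smult (1 / (X - cst i)) dx)"

definition theta ::
  "complex \<Rightarrow> complex \<Rightarrow> complex \<Rightarrow> complex \<Rightarrow> complex \<Rightarrow> complex \<Rightarrow>
   complex \<Rightarrow> complex \<Rightarrow> complex \<Rightarrow> differential^2^2" where
  "theta r s t R S T cr cs ct =
     scale_matrix cr (theta_basic r R)
   + scale_matrix cs (theta_basic s S)
   + scale_matrix ct (theta_basic t T)"

definition h0 ::
  "complex \<Rightarrow> complex \<Rightarrow> complex \<Rightarrow> complex \<Rightarrow> complex \<Rightarrow> complex \<Rightarrow>
   complex \<Rightarrow> complex \<Rightarrow> complex \<Rightarrow> complex" where
  "h0 r s t R S T cr cs ct =
     (cr * (R - 1) + cs * (S - 1) + ct * (T - 1))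
   * (cr * s * t * (R - r) * R + cs * r * t * (S - s) * S + ct * r * s * (T - t) * T)"

definition h1 ::
  "complex \<Rightarrow> complex \<Rightarrow> complex \<Rightarrow> complex \<Rightarrow> complex \<Rightarrow> complex \<Rightarrow>
   complex \<Rightarrow> complex \<Rightarrow> complex \<Rightarrow> complex" where
  "h1 r s t R S T cr cs ct =
     cr * (cr * (s + t) * (r + 1) + cs * s * (t + 1) + ct * t * (s + 1)) * R^2
       - cr^2 * (t + s) * R^3
   + cs * (cs * (r + t) * (s + 1) + cr * r * (t + 1) + ct * t * (r + 1)) * S^2
       - cs^2 * (t + r) * S^3
   + ct * (ct * (r + s) * (t + 1) + cr * r * (s + 1) + cs * s * (r + 1)) * T^2
       - ct^2 * (r + s) * T^3
   - cr * cs * (t * (R - 1 + S - 1) + r * (S - s) + s * (R - r)) * R * S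
   - cr * ct * (s * (R - 1 + T - 1) + r * (T - t) + t * (R - r)) * R * T
   - cs * ct * (r * (S - 1 + T - 1) + s * (T - t) + t * (S - s)) * S * T
   - (ct * t * (r + s) + cr * r * (s + t) + cs * s * (r + t)) * (cr * R + cs * S + ct * T)"

definition h2 ::
  "complex \<Rightarrow> complex \<Rightarrow> complex \<Rightarrow> complex \<Rightarrow> complex \<Rightarrow> complex \<Rightarrow>
   complex \<Rightarrow> complex \<Rightarrow> complex \<Rightarrow> complex" where
  "h2 r s t R S T cr cs ct =
     (cr * (R - 1) * R + cs * (S - 1) * S + ct * (T - 1) * T)
   * (cr * (R - r) + cs * (S - s) + ct * (T - t))"

text \<open>
  Sign: with \<open>h0\<close>, \<open>h1\<close>, \<open>h2\<close> as above, the usual determinant of \<open>theta\<close> is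
  \<open>- (h2 x\<^sup>2 + h1 x + h0) (dx)\<^sup>\<otimes>\<^sup>2 / (x(x-1)(x-r)(x-s)(x-t))\<close>; the formula without the minus sign
  is false. For instance, for \<open>cs = ct = 0\<close> one computes
  \<open>det theta = - cr\<^sup>2 R (R-1) (R-r) (dx)\<^sup>\<otimes>\<^sup>2 / (x(x-1)(x-r))\<close>, whereas
  \<open>h2 x\<^sup>2 + h1 x + h0 = cr\<^sup>2 R (R-1) (R-r) (x-s)(x-t)\<close>.
\<close>

end

theory Submission
  imports Defs
begin

text \<open>
  Each basic field has the denominator \<open>(x-1)(x-i)\<close>, so \<open>det theta\<close> has the denominator
  \<open>x(x-1)\<^sup>2(x-r)\<^sup>2(x-s)\<^sup>2(x-t)\<^sup>2\<close>. Its numerator is a quadratic form in \<open>(cr, cs, ct)\<close>. Every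
  polarised coefficient is divisible by \<open>x-1\<close>, and the diagonal ones moreover by the respective \<open>x-i\<close>
  (the residues are nilpotent), which removes one factor from each square and leaves the quadratic
  polynomial \<open>h2 x\<^sup>2 + h1 x + h0\<close>.
\<close>

lemma cst_0: "cst 0 = 0"
  and cst_1: "cst 1 = 1"
  and cst_add: "cst (a + b) = cst a + cst b"
  and cst_diff: "cst (a - b) = cst a - cst b"
  and cst_minus: "cst (- a) = - cst a"
  and cst_mult: "cst (a * b) = cst a * cst b"
  by (simp_all add: cst_def flip: to_fract_add to_fract_diff to_fract_uminus to_fract_mult one_pCons)

lemma cst_power: "cst (a ^ n) = cst a ^ n"
  by (induction n) (simp_all add: cst_1 cst_mult)

lemmas cst_hom = cst_0 cst_1 cst_add cst_diff cst_minus cst_mult cst_power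

lemma X_neq_cst: "X \<noteq> cst a"
  by (simp add: X_def cst_def)

text \<open>The residue at 0 is strictly lower triangular, so only the (2,1) entry has a pole there,
  kept apart as \<open>/ X\<close>. The residues of that entry sum to zero, which leaves its
  numerator linear in \<open>X\<close>.\<close>

lemma theta_basic_nth:
  fixes i Z :: complex
  defines "q \<equiv> (X - 1) * (X - cst i)"
  shows "theta_basic i Z $ 1 $ 1 = smult (cst Z * (1 - cst i) / q) dx"
    and "theta_basic i Z $ 1 $ 2 = smult (cst Z * ((cst Z - 1) * X + (cst i - cst Z)) / q) dx"
    and "theta_basic i Z $ 2 $ 1 = smult (((cst Z - cst i) * X + cst i * (1 - cst Z)) / X / q) dx"
    and "theta_basic i Z $ 2 $ 2 = smult (- (cst Z * (1 - cst i)) / q) dx"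
proof -
  have [simp]: "X \<noteq> 0" "X \<noteq> 1" "X \<noteq> cst i"
    using X_neq_cst[of 0] X_neq_cst[of 1] X_neq_cst[of i] by (simp_all add: cst_0 cst_1)
  have e: "cst Z / (X - 1) - cst Z / (X - cst i) = cst Z * (1 - cst i) / q"
    "- (cst Z / (X - 1)) + (cst Z)\<^sup>2 / (X - cst i) = cst Z * ((cst Z - 1) * X + (cst i - cst Z)) / q"
    "(1 - cst Z) / X + cst Z / (X - 1) - 1 / (X - cst i)
      = ((cst Z - cst i) * X + cst i * (1 - cst Z)) / X / q"
    by (simp_all add: q_def divide_simps) (simp_all add: algebra_simps power2_eq_square)
  show "theta_basic i Z $ 1 $ 1 = smult (cst Z * (1 - cst i) / q) dx"
    "theta_basic i Z $ 1 $ 2 = smult (cst Z * ((cst Z - 1) * X + (cst i - cst Z)) / q) dx"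
    "theta_basic i Z $ 2 $ 1 = smult (((cst Z - cst i) * X + cst i * (1 - cst Z)) / X / q) dx"
    "theta_basic i Z $ 2 $ 2 = smult (- (cst Z * (1 - cst i)) / q) dx"
    \<comment> \<open>Pulling the sign out of the fraction lets the first equation of
      \<open>e\<close> serve the (2,2) entry too.\<close>
    unfolding minus_divide_left[symmetric] e[symmetric]
    by (simp_all add: theta_basic_def matrix_times_form_def cst_hom
        flip: smult_add_left smult_diff_left)
qed

lemma diagonal_numerator:
  fixes x i Z :: "'a::comm_ring_1"
  shows "x * (Z * (1 - i))\<^sup>2 + Z * ((Z - 1) * x + (i - Z)) * ((Z - i) * x + i * (1 - Z))
    = (x - 1) * (Z * (Z - 1) * (Z - i) * (x - i))"
  by (simp add: algebra_simps power2_eq_square)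

text \<open>The residues at 1 of all basic fields are multiples of one nilpotent matrix, hence the
  factor \<open>x - 1\<close>. At \<open>i\<close> and \<open>j\<close> the product of two different
  denominators has only simple zeros, so no further factor has to come out.\<close>

lemma mixed_numerator:
  fixes x i j Z W :: "'a::comm_ring_1"
  shows "2 * x * (Z * (1 - i)) * (W * (1 - j))
      + Z * ((Z - 1) * x + (i - Z)) * ((W - j) * x + j * (1 - W))
      + W * ((W - 1) * x + (j - W)) * ((Z - i) * x + i * (1 - Z))
    = (x - 1) * ((Z * (Z - 1) * (W - j) + W * (W - 1) * (Z - i)) * x
        - ((Z - 1) * i * (W - j) * W + (W - 1) * j * (Z - i) * Z))"
  by (simp add: algebra_simps power2_eq_square)

text \<open>Here \<open>e\<close>, \<open>lr\<close>, \<open>ls\<close>, \<open>lt\<close> stand for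
  the linear forms \<open>x - 1\<close>, \<open>x - r\<close>, \<open>x - s\<close>,
  \<open>x - t\<close>; keeping them opaque keeps the expansion small. Clearing denominators gives
  every mixed term the factor \<open>lr * ls * lt\<close>; a diagonal term gets its missing factor
  from the first three assumptions.\<close>

lemma quadratic_form_factor:
  fixes x e :: "'a::comm_ring_1"
  assumes "x * a1\<^sup>2 + b1 * g1 = e * (qr * lr)" "x * a2\<^sup>2 + b2 * g2 = e * (qs * ls)"
    and "x * a3\<^sup>2 + b3 * g3 = e * (qt * lt)"
    and "2 * x * a1 * a2 + b1 * g2 + b2 * g1 = e * mrs"
    and "2 * x * a1 * a3 + b1 * g3 + b3 * g1 = e * mrt"
    and "2 * x * a2 * a3 + b2 * g3 + b3 * g2 = e * mst"
  shows "x * (cr * a1 * (ls * lt) + cs * a2 * (lr * lt) + ct * a3 * (lr * ls))\<^sup>2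
      + (cr * b1 * (ls * lt) + cs * b2 * (lr * lt) + ct * b3 * (lr * ls))
        * (cr * g1 * (ls * lt) + cs * g2 * (lr * lt) + ct * g3 * (lr * ls))
    = (cr\<^sup>2 * qr * (ls * lt) + cs\<^sup>2 * qs * (lr * lt) + ct\<^sup>2 * qt * (lr * ls)
        + cr * cs * mrs * lt + cr * ct * mrt * ls + cs * ct * mst * lr) * (e * lr * ls * lt)"
    (is "?L = ?R")
proof -
  have "?L = cr\<^sup>2 * (x * a1\<^sup>2 + b1 * g1) * (ls * lt)\<^sup>2 + cs\<^sup>2 * (x * a2\<^sup>2 + b2 * g2) * (lr * lt)\<^sup>2
      + ct\<^sup>2 * (x * a3\<^sup>2 + b3 * g3) * (lr * ls)\<^sup>2
      + cr * cs * (2 * x * a1 * a2 + b1 * g2 + b2 * g1) * (lr * ls * lt\<^sup>2)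
      + cr * ct * (2 * x * a1 * a3 + b1 * g3 + b3 * g1) * (lr * lt * ls\<^sup>2)
      + cs * ct * (2 * x * a2 * a3 + b2 * g3 + b3 * g2) * (ls * lt * lr\<^sup>2)"
    by (simp add: algebra_simps power2_eq_square)
  also have "\<dots> = ?R"
    unfolding assms by (simp add: algebra_simps power2_eq_square)
  finally show ?thesis .
qed

text \<open>Sorts the Hamiltonians by monomials in \<open>cr\<close>, \<open>cs\<close>,
  \<open>ct\<close>, in exactly the shape of the cofactor in \<open>quadratic_form_factor\<close>. A
  general ring is used so that it applies to the images under \<open>cst\<close>.\<close>

lemma hitchin_hamiltonian_expand:
  fixes x r s t R S T cr cs ct :: "'a::comm_ring_1"
  shows "(cr * (R - 1) * R + cs * (S - 1) * S + ct * (T - 1) * T)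
           * (cr * (R - r) + cs * (S - s) + ct * (T - t)) * x\<^sup>2
     + (cr * (cr * (s + t) * (r + 1) + cs * s * (t + 1) + ct * t * (s + 1)) * R^2
       - cr^2 * (t + s) * R^3
   + cs * (cs * (r + t) * (s + 1) + cr * r * (t + 1) + ct * t * (r + 1)) * S^2
       - cs^2 * (t + r) * S^3
   + ct * (ct * (r + s) * (t + 1) + cr * r * (s + 1) + cs * s * (r + 1)) * T^2
       - ct^2 * (r + s) * T^3
   - cr * cs * (t * (R - 1 + S - 1) + r * (S - s) + s * (R - r)) * R * S
   - cr * ct * (s * (R - 1 + T - 1) + r * (T - t) + t * (R - r)) * R * T
   - cs * ct * (r * (S - 1 + T - 1) + s * (T - t) + t * (S - s)) * S * T
   - (ct * t * (r + s) + cr * r * (s + t) + cs * s * (r + t)) * (cr * R + cs * S + ct * T)) * x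
     + (cr * (R - 1) + cs * (S - 1) + ct * (T - 1))
   * (cr * s * t * (R - r) * R + cs * r * t * (S - s) * S + ct * r * s * (T - t) * T)
    = cr\<^sup>2 * (R * (R - 1) * (R - r)) * ((x - s) * (x - t))
      + cs\<^sup>2 * (S * (S - 1) * (S - s)) * ((x - r) * (x - t))
      + ct\<^sup>2 * (T * (T - 1) * (T - t)) * ((x - r) * (x - s))
      + cr * cs * ((R * (R - 1) * (S - s) + S * (S - 1) * (R - r)) * x
        - ((R - 1) * r * (S - s) * S + (S - 1) * s * (R - r) * R)) * (x - t)
      + cr * ct * ((R * (R - 1) * (T - t) + T * (T - 1) * (R - r)) * x
        - ((R - 1) * r * (T - t) * T + (T - 1) * t * (R - r) * R)) * (x - s)
      + cs * ct * ((S * (S - 1) * (T - t) + T * (T - 1) * (S - s)) * x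
        - ((S - 1) * s * (T - t) * T + (T - 1) * t * (S - s) * S)) * (x - r)"
  by (simp add: algebra_simps power2_eq_square power3_eq_cube)

text \<open>The minus sign of the theorem originates here.\<close>

lemma det_trace_free_form:
  fixes M :: "differential^2^2"
  assumes "M $ 1 $ 1 = smult a \<omega>" "M $ 1 $ 2 = smult b \<omega>" "M $ 2 $ 1 = smult c \<omega>"
    and "M $ 2 $ 2 = smult (- a) \<omega>"
  shows "det M = - smult (a\<^sup>2 + b * c) (\<omega>\<^sup>2)"
  using assms by (simp add: det_2 power2_eq_square algebra_simps smult_add_left)

theorem mainTheorem2:
  fixes r s t R S T cr cs ct :: complex
  assumes "r \<notin> {0, 1}" and "s \<notin> {0, 1}" and "t \<notin> {0, 1}"
    and "r \<noteq> s" and "r \<noteq> t" and "s \<noteq> t"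
  shows "det (theta r s t R S T cr cs ct) =
    - smult ((cst (h2 r s t R S T cr cs ct) * X^2 + cst (h1 r s t R S T cr cs ct) * X
                + cst (h0 r s t R S T cr cs ct))
             / (X * (X - 1) * (X - cst r) * (X - cst s) * (X - cst t)))
        (dx^2)"
proof -
  have nz: "X \<noteq> 0" "X \<noteq> 1" "X \<noteq> cst a" for a
    using X_neq_cst[of 0] X_neq_cst[of 1] X_neq_cst[of a] by (simp_all add: cst_0 cst_1)
  define d where "d = (X - 1) * (X - cst r) * (X - cst s) * (X - cst t)"
  have d: "d \<noteq> 0" by (simp add: d_def nz)
  \<comment> \<open>\<open>N f\<close> is the numerator over \<open>d\<close> of the combination of
    the three basic entries with numerators \<open>f\<close>; abstracting over \<open>f\<close>
    treats all entries at once.\<close>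
  define N where "N = (\<lambda>f. cst cr * f r R * ((X - cst s) * (X - cst t))
      + cst cs * f s S * ((X - cst r) * (X - cst t)) + cst ct * f t T * ((X - cst r) * (X - cst s)))"
  define A where "A = N (\<lambda>i Z. cst Z * (1 - cst i))"
  define B where "B = N (\<lambda>i Z. cst Z * ((cst Z - 1) * X + (cst i - cst Z)))"
  define C where "C = N (\<lambda>i Z. (cst Z - cst i) * X + cst i * (1 - cst Z))"
  define H where "H = cst (h2 r s t R S T cr cs ct) * X\<^sup>2 + cst (h1 r s t R S T cr cs ct) * X
    + cst (h0 r s t R S T cr cs ct)"
  have common: "cst cr * (f r R / ((X - 1) * (X - cst r))) + cst cs * (f s S / ((X - 1) * (X - cst s)))
      + cst ct * (f t T / ((X - 1) * (X - cst t))) = N f / d" for f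
    by (simp add: N_def d_def nz add_divide_distrib)
  have N_divide: "N (\<lambda>i Z. f i Z / X) = N f / X" for f
    by (simp add: N_def add_divide_distrib)
  have "theta r s t R S T cr cs ct $ 1 $ 1 = smult (A / d) dx"
    "theta r s t R S T cr cs ct $ 1 $ 2 = smult (B / d) dx"
    "theta r s t R S T cr cs ct $ 2 $ 2 = smult (- (A / d)) dx"
    unfolding A_def B_def common[symmetric]
    by (simp_all add: theta_def scale_matrix_def theta_basic_nth smult_add_left smult_diff_left)
  moreover have "theta r s t R S T cr cs ct $ 2 $ 1
      = smult (N (\<lambda>i Z. ((cst Z - cst i) * X + cst i * (1 - cst Z)) / X) / d) dx"
    unfolding common[symmetric]
    by (simp only: theta_def scale_matrix_def theta_basic_nth smult_add_left smult_smult
        vector_add_component vec_lambda_beta)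
  then have "theta r s t R S T cr cs ct $ 2 $ 1 = smult (C / X / d) dx"
    by (simp only: C_def N_divide)
  ultimately have "det (theta r s t R S T cr cs ct) = - smult ((A / d)\<^sup>2 + B / d * (C / X / d)) (dx\<^sup>2)"
    by (intro det_trace_free_form)
  \<comment> \<open>Only \<open>C\<close> carries \<open>1 / X\<close>, so the pole at 0 stays
    simple while \<open>d\<close> appears squared.\<close>
  also have "(A / d)\<^sup>2 + B / d * (C / X / d) = (X * A\<^sup>2 + B * C) / (X * d\<^sup>2)"
    using d nz(1) by (simp add: field_simps power2_eq_square)
  also have "X * A\<^sup>2 + B * C = H * d"
    unfolding A_def B_def C_def N_def H_def d_def h0_def h1_def h2_def cst_hom
      hitchin_hamiltonian_expand
    \<comment> \<open>The six divisibility premises are the three diagonal and the three mixed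
      identities.\<close>
    by (rule quadratic_form_factor diagonal_numerator mixed_numerator)+
  also have "H * d / (X * d\<^sup>2) = H / (X * d)"
    using d by (simp add: power2_eq_square)
  finally show ?thesis
    by (simp only: H_def d_def mult.assoc)
qed

end
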